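(* Let $n\ge 1$ and $x_1,\ldots,x_{2n}$ real numbers, and let $\bar A=(a_{i,j})_{1\le i<j\le 2n}$ with $a_{i,j}=\cos(x_i-x_j)$. Then $$pf_{2n}\bar A=\cos(x_1-x_2+x_3-x_4+\cdots+x_{2n-1}-x_{2n}).$$
   Context: For a triangular array $\bar A=(a_{i,j})_{1\le i<j\le 2n}$ its Pfaffian is $pf_{2n}\bar A=\sum_{\pi}\operatorname{sign}(\pi)\,a_{i_1,j_1}\cdots a_{i_n,j_n}$, the sum over all permutations $\pi\in S_{2n}$ with one-line notation $(i_1,j_1,\ldots,i_n,j_n)$ satisfying $i_1<i_2<\cdots<i_n$ and $i_s<j_s$ for all $s$; $\operatorname{sign}(\pi)$ is the sign of the permutation. *)

theory Defs
  imports Complex_Main "HOL-Combinatorics.Permutations"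
begin

text \<open>
  A permutation of \<open>{1..2 * n}\<close> has one-line notation \<open>(i\<^sub>1, j\<^sub>1, \<dots>, i\<^sub>n, j\<^sub>n)\<close> with
  \<open>i\<^sub>s = p (2 * s - 1)\<close> and \<open>j\<^sub>s = p (2 * s)\<close>.
\<close>

definition pf_perms :: "nat \<Rightarrow> (nat \<Rightarrow> nat) set" where
  "pf_perms n = {p. p permutes {1..2 * n} \<and>
     strict_mono_on {1..n} (\<lambda>s. p (2 * s - 1)) \<and>
     (\<forall>s\<in>{1..n}. p (2 * s - 1) < p (2 * s))}"

text \<open>
  A triangular array is a function of two indices, of which only the values \<open>a i j\<close> with
  \<open>1 \<le> i < j \<le> 2 * n\<close> matter. The parameter \<open>n\<close> is half the size of the array:
  \<open>pfaffian n\<close> is usually written \<open>pf\<close> with subscript \<open>2n\<close>.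
\<close>

definition pfaffian :: "nat \<Rightarrow> (nat \<Rightarrow> nat \<Rightarrow> 'a::comm_ring_1) \<Rightarrow> 'a" where
  "pfaffian n a = (\<Sum>p\<in>pf_perms n. of_int (sign p) * (\<Prod>s=1..n. a (p (2 * s - 1)) (p (2 * s))))"

end

theory Submission
  imports Defs
begin

text \<open>
  Expanding along the first row, \<open>pf A = \<Sum>\<^sub>j (-1)\<^sup>j a\<^sub>1\<^sub>j pf A\<^sub>j\<close> with rows and columns
  \<open>1, j\<close> deleted in \<open>A\<^sub>j\<close>, reduces the claim by induction to a trigonometric identity for
  \<open>\<Sum>\<^sub>j (-1)\<^sup>j cos (x\<^sub>1 - x\<^sub>j) cos \<beta>\<^sub>j\<close>, where \<open>\<beta>\<^sub>j\<close> is the alternating sum of the remaining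
  variables. Turning each product into a sum of two cosines gives two telescoping sums, each of
  which leaves one copy of \<open>cos (x\<^sub>1 - x\<^sub>2 + \<dots> - x\<^sub>2\<^sub>n) / 2\<close>.
\<close>

section \<open>Transporting permutations of \<open>{1..m}\<close> to permutations of
  \<open>{1..m + 2}\<close> that fix 1 and 2\<close>

text \<open>The point 2 falls under the second branch: a permutation of \<open>{1..m}\<close> fixes
  0, so its shift fixes 2. This makes the map a plain translation by 2, compatible with composition
  and transpositions without side conditions.\<close>

definition shift2 :: "(nat \<Rightarrow> nat) \<Rightarrow> nat \<Rightarrow> nat" where
  "shift2 q k = (if k < 2 then k else q (k - 2) + 2)"

lemma shift2_add_2 [simp]: "shift2 q (k + 2) = q k + 2" "shift2 q (Suc (Suc k)) = Suc (Suc (q k))"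
  by (auto simp: shift2_def)

lemma shift2_inject [simp]: "shift2 q = shift2 r \<longleftrightarrow> q = r"
proof
  assume "shift2 q = shift2 r"
  then have "q k + 2 = r k + 2" for k
    by (metis shift2_add_2(1))
  then show "q = r" by auto
qed simp

lemma shift2_id [simp]: "shift2 id = id"
  by (auto simp: shift2_def fun_eq_iff)

lemma shift2_comp: "shift2 (q \<circ> r) = shift2 q \<circ> shift2 r"
  by (auto simp: shift2_def fun_eq_iff)

lemma shift2_transpose: "shift2 (transpose a b) = transpose (a + 2) (b + 2)"
  by (auto simp: shift2_def fun_eq_iff transpose_def)

lemma permutes_shift2:
  assumes "q permutes {1..m}"
  shows "shift2 q permutes {1..m + 2}"
proof (rule bij_imp_permutes)
  have q: "inj q" "surj q" "\<And>k. k \<notin> {1..m} \<Longrightarrow> q k = k"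
    using assms by (auto simp: permutes_inj permutes_surj permutes_not_in)
  show outside: "shift2 q k = k" if "k \<notin> {1..m + 2}" for k
  proof (cases "k < 2")
    case False
    then have "k - 2 \<notin> {1..m}" using that by auto
    with False q(3)[of "k - 2"] show ?thesis by (simp add: shift2_def)
  qed (simp add: shift2_def)
  have range: "shift2 q k \<in> {1..m + 2}" if "k \<in> {1..m + 2}" for k
    using that permutes_in_image[OF assms, of "k - 2"] q(3)[of 0]
    by (cases "k = 2") (auto simp: shift2_def)
  have "inj_on (shift2 q) {1..m + 2}"
  proof (rule inj_onI)
    fix k l assume "k \<in> {1..m + 2}" "l \<in> {1..m + 2}" "shift2 q k = shift2 q l"
    then have "k < 2 \<longleftrightarrow> l < 2" "\<not> k < 2 \<longrightarrow> k - 2 = l - 2" "k \<ge> 1" "l \<ge> 1"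
      using q(1) by (auto simp: shift2_def inj_eq split: if_splits)
    then show "k = l" by linarith
  qed
  moreover have "shift2 q ` {1..m + 2} \<subseteq> {1..m + 2}"
    using range by blast
  ultimately show "bij_betw (shift2 q) {1..m + 2} {1..m + 2}"
    by (simp add: bij_betw_def endo_inj_surj)
qed

text \<open>Translating \<open>r\<close> back by 2 inverts \<open>shift2\<close>. This supplies the
  residual permutation when an element of \<open>pf_perms (Suc n)\<close> is decomposed.\<close>

lemma shift2_surj:
  assumes "r permutes {1..m + 2}" "r 1 = 1" "r 2 = 2"
  obtains q where "q permutes {1..m}" "r = shift2 q"
proof
  define q where "q k = r (k + 2) - 2" for k
  \<comment> \<open>The values 0 and 1 are already taken at 0 and 1, so the truncated subtraction in
    \<open>q\<close> loses nothing.\<close>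
  have ge: "r (k + 2) \<ge> 2" for k
  proof -
    have "r 0 = 0" using assms(1) by (auto intro: permutes_not_in)
    moreover have "r (k + 2) \<noteq> r 0" "r (k + 2) \<noteq> r 1"
      using permutes_inj[OF assms(1)] by (simp_all add: inj_eq)
    ultimately show ?thesis using assms(2) by linarith
  qed
  show r: "r = shift2 q"
  proof
    fix k show "r k = shift2 q k"
    proof (cases "k < 2")
      case True
      have "r 0 = 0" using assms(1) by (auto intro: permutes_not_in)
      with True show ?thesis using assms(2) by (cases k) (auto simp: shift2_def)
    next
      case False
      then show ?thesis using ge[of "k - 2"] 
        by (simp add: shift2_def q_def del: add_2_eq_Suc')
    qed
  qed
  show "q permutes {1..m}"
  proof (rule bij_imp_permutes)
    show outside: "q k = k" if "k \<notin> {1..m}" for k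
    proof (cases "k = 0")
      case True then show ?thesis using assms(3) by (simp add: q_def numeral_2_eq_2)
    next
      case False
      then have "k + 2 \<notin> {1..m + 2}" using that by auto
      then show ?thesis using permutes_not_in[OF assms(1)] by (simp add: q_def)
    qed
    have inj: "inj q"
    proof (rule injI)
      fix k l assume "q k = q l"
      then have "r (k + 2) = r (l + 2)" by (simp add: r)
      then show "k = l" using permutes_inj[OF assms(1)] by (simp add: inj_eq)
    qed
    have "q k \<in> {1..m}" if "k \<in> {1..m}" for k
    proof -
      have "r (k + 2) \<in> {1..m + 2}" using that by (subst permutes_in_image[OF assms(1)]) auto
      \<comment> \<open>Since \<open>q 0 = 0\<close>, injectivity excludes the value 0, that is,
        \<open>r (k + 2) = 2\<close>.\<close>
      moreover have "q k \<noteq> q 0" using inj that by (auto simp: inj_eq)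
      ultimately show ?thesis using outside[of 0] by (auto simp: r)
    qed
    then have "q ` {1..m} \<subseteq> {1..m}" by blast
    then show "bij_betw q {1..m} {1..m}"
      using inj_on_subset[OF inj subset_UNIV] by (simp add: bij_betw_def endo_inj_surj)
  qed
qed

text \<open>Building \<open>q\<close> up from transpositions, \<open>shift2\<close> turns each
  factor into another nontrivial transposition, so the parity is unchanged.\<close>

lemma sign_shift2:
  assumes "q permutes {1..m}"
  shows "sign (shift2 q) = sign q"
  using assms finite_atLeastAtMost
proof (induction rule: permutes_induct)
  case id
  show ?case by (simp only: shift2_id)
next
  case (swap a b p)
  have "permutation p" "permutation (shift2 p)"
    using swap(4) permutes_shift2[OF swap(4)] permutation_permutes by blast+
  then show ?case
    using swap(3,5)
    by (simp only: shift2_comp shift2_transpose sign_compose[OF permutation_swap_id] sign_swap_id) simp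
qed

section \<open>The cycle that moves \<open>j\<close> to position 2\<close>

text \<open>
  The values \<open>front_cycle j (k + 2)\<close>, \<open>k \<ge> 1\<close>, enumerate in increasing order the indices that
  remain after deleting \<open>1\<close> and \<open>j\<close>.
\<close>

definition front_cycle :: "nat \<Rightarrow> nat \<Rightarrow> nat" where
  "front_cycle j k = (if k = 2 then j else if 2 < k \<and> k \<le> j then k - 1 else k)"

lemma front_cycle_2: "front_cycle 2 = id"
  by (auto simp: front_cycle_def fun_eq_iff)

text \<open>Iterated from \<open>front_cycle_2\<close>, this writes the cycle as a product of
  \<open>j - 2\<close> adjacent transpositions; both its range and its sign follow by
  induction.\<close>

lemma front_cycle_Suc:
  assumes "2 \<le> j"
  shows "front_cycle (Suc j) = transpose j (Suc j) \<circ> front_cycle j"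
  using assms by (auto simp: front_cycle_def fun_eq_iff transpose_def)

lemma permutes_front_cycle:
  assumes "2 \<le> j" "j \<le> m"
  shows "front_cycle j permutes {1..m}"
  using assms
proof (induction j rule: dec_induct)
  case base
  then show ?case by (simp only: front_cycle_2 permutes_id)
next
  case (step j)
  have "transpose j (Suc j) permutes {1..m}"
    using step by (intro permutes_swap_id) auto
  moreover have "front_cycle j permutes {1..m}"
    using step by simp
  ultimately show ?case
    using step(1) by (simp only: front_cycle_Suc permutes_compose)
qed

lemma sign_front_cycle:
  assumes "2 \<le> j"
  shows "sign (front_cycle j) = (-1) ^ j"
  using assms
proof (induction j rule: dec_induct)
  case base
  then show ?case by (simp add: front_cycle_2)
next
  case (step j)
  have "permutation (front_cycle j)"
    using permutes_front_cycle[OF step(1) order_refl] permutation_permutes by blast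
  then show ?case
    using step(1,3)
    by (simp only: front_cycle_Suc sign_compose[OF permutation_swap_id] sign_swap_id) simp
qed

lemma front_cycle_less_iff:
  assumes "1 \<le> k" "1 \<le> l"
  shows "front_cycle j (k + 2) < front_cycle j (l + 2) \<longleftrightarrow> k < l"
  using assms by (auto simp: front_cycle_def)

section \<open>Recursive structure of the permutations indexing the Pfaffian\<close>

lemma pf_perms_0: "pf_perms 0 = {id}"
  by (auto simp: pf_perms_def strict_mono_on_def)

text \<open>The value 1 cannot stand in an even position, where its predecessor would be smaller,
  nor in an odd position after the first, where \<open>p 1\<close> would be smaller.\<close>

lemma pf_perms_fix_1:
  assumes "p \<in> pf_perms (Suc n)"
  shows "p 1 = 1"
proof -
  have p: "p permutes {1..2 * Suc n}" "strict_mono_on {1..Suc n} (\<lambda>s. p (2 * s - 1))"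
    "\<And>s. s \<in> {1..Suc n} \<Longrightarrow> p (2 * s - 1) < p (2 * s)"
    using assms by (auto simp: pf_perms_def)
  have "1 \<in> p ` {1..2 * Suc n}"
    using permutes_image[OF p(1)] by auto
  then obtain k where k: "k \<in> {1..2 * Suc n}" "p k = 1" by auto
  have pos: "p l \<ge> 1" if "l \<in> {1..2 * Suc n}" for l
    using permutes_in_image[OF p(1), of l] that by auto
  show ?thesis
  proof (cases "even k")
    case True
    then obtain s where s: "k = 2 * s" by blast
    then have "p (2 * s - 1) < 1" using p(3)[of s] k by auto
    moreover have "p (2 * s - 1) \<ge> 1" using s k by (intro pos) auto
    ultimately show ?thesis by simp
  next
    case False
    then obtain s where "k = 2 * s + 1" by (elim oddE)
    then have s: "k = 2 * Suc s - 1" by simp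
    show ?thesis
    proof (cases "s = 0")
      case True then show ?thesis using s k by simp
    next
      case False
      have "p (2 * 1 - 1) < p (2 * Suc s - 1)"
        using s k False by (intro strict_mono_onD[OF p(2)]) auto
      then have "p 1 < 1" using s k by simp
      moreover have "p 1 \<ge> 1" by (intro pos) auto
      ultimately show ?thesis by simp
    qed
  qed
qed

text \<open>The composite begins with 1 and \<open>j\<close>; its later entries are those of
  \<open>q\<close> relabelled increasingly, so the order conditions on them agree. The conditions
  involving the first pair hold because 1 is the least entry.\<close>

lemma front_cycle_shift2_mem_pf_perms_iff:
  assumes j: "j \<in> {2..2 * n + 2}" and q: "q permutes {1..2 * n}"
  shows "front_cycle j \<circ> shift2 q \<in> pf_perms (Suc n) \<longleftrightarrow> q \<in> pf_perms n"
proof -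
  let ?p = "front_cycle j \<circ> shift2 q"
  have perm: "?p permutes {1..2 * Suc n}"
    using permutes_compose[OF permutes_shift2[OF q] permutes_front_cycle[of j]] j by simp
  have pos: "q k \<ge> 1" if "k \<in> {1..2 * n}" for k
    using permutes_in_image[OF q, of k] that by auto
  have p1: "?p 1 = 1" and p2: "?p 2 = j"
    using permutes_not_in[OF q, of 0] by (auto simp: front_cycle_def shift2_def)
  have odd: "?p (2 * Suc s - 1) = front_cycle j (q (2 * s - 1) + 2)"
    and even: "?p (2 * Suc s) = front_cycle j (q (2 * s) + 2)" if "s \<in> {1..n}" for s
    using that by (auto simp: shift2_def)
  have less: "front_cycle j (q k + 2) < front_cycle j (q l + 2) \<longleftrightarrow> q k < q l"
    if "k \<in> {1..2 * n}" "l \<in> {1..2 * n}" for k l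
    using that by (intro front_cycle_less_iff pos)
  have "strict_mono_on {1..Suc n} (\<lambda>s. ?p (2 * s - 1)) \<longleftrightarrow> strict_mono_on {1..n} (\<lambda>s. q (2 * s - 1))"
    (is "?L \<longleftrightarrow> ?R")
  proof
    assume L: ?L
    show ?R
    proof (rule strict_mono_onI)
      fix s t assume st: "s \<in> {1..n}" "t \<in> {1..n}" "s < t"
      have "?p (2 * Suc s - 1) < ?p (2 * Suc t - 1)"
        using st by (intro strict_mono_onD[OF L]) auto
      then show "q (2 * s - 1) < q (2 * t - 1)"
        unfolding odd[OF st(1)] odd[OF st(2)] using st by (subst (asm) less) auto
    qed
  next
    assume R: ?R
    show ?L
    proof (rule strict_mono_onI)
      fix s t assume st: "s \<in> {1..Suc n}" "t \<in> {1..Suc n}" "s < t"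
      then obtain t' where t': "t = Suc t'" "t' \<in> {1..n}" by (cases t) auto
      show "?p (2 * s - 1) < ?p (2 * t - 1)"
      proof (cases "s = 1")
        case True
        have "q (2 * t' - 1) \<ge> 1" using t' by (intro pos) auto
        \<comment> \<open>Arguments of at least 3 are lowered by at most one, so they never reach
          1.\<close>
        then have "1 < front_cycle j (q (2 * t' - 1) + 2)"
          using j by (auto simp: front_cycle_def)
        then show ?thesis unfolding t'(1) odd[OF t'(2)] using True p1 by simp
      next
        case False
        then obtain s' where s': "s = Suc s'" "s' \<in> {1..n}" using st by (cases s) auto
        have "q (2 * s' - 1) < q (2 * t' - 1)"
          using st s' t' by (intro strict_mono_onD[OF R]) auto
        then show ?thesis
          unfolding s'(1) t'(1) odd[OF s'(2)] odd[OF t'(2)] using s' t' by (subst less) auto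
      qed
    qed
  qed
  moreover have "(\<forall>s\<in>{1..Suc n}. ?p (2 * s - 1) < ?p (2 * s)) \<longleftrightarrow>
      (\<forall>s\<in>{1..n}. q (2 * s - 1) < q (2 * s))"
  proof -
    have "{1..Suc n} = insert 1 (Suc ` {1..n})"
      by (auto simp: image_Suc_atLeastAtMost)
    then have "(\<forall>s\<in>{1..Suc n}. ?p (2 * s - 1) < ?p (2 * s)) \<longleftrightarrow>
        ?p (2 * 1 - 1) < ?p (2 * 1) \<and> (\<forall>s\<in>{1..n}. ?p (2 * Suc s - 1) < ?p (2 * Suc s))"
      by (simp only: ball_simps)
    moreover have "?p (2 * 1 - 1) < ?p (2 * 1)" using p1 p2 j by simp
    moreover have "(\<forall>s\<in>{1..n}. ?p (2 * Suc s - 1) < ?p (2 * Suc s)) \<longleftrightarrow>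
        (\<forall>s\<in>{1..n}. q (2 * s - 1) < q (2 * s))"
      by (intro ball_cong refl) (simp only: odd even, subst less, auto)
    ultimately show ?thesis by (simp only: simp_thms)
  qed
  ultimately show ?thesis
    using perm q by (simp only: pf_perms_def mem_Collect_eq simp_thms)
qed

text \<open>Here \<open>j\<close> is the partner of 1, and \<open>q\<close> is the arrangement of
  the other pairs after order-preserving relabelling.\<close>

lemma bij_betw_pf_perms_Suc:
  "bij_betw (\<lambda>(j, q). front_cycle j \<circ> shift2 q) ({2..2 * n + 2} \<times> pf_perms n) (pf_perms (Suc n))"
proof (rule bij_betw_imageI)
  have perm: "q permutes {1..2 * n}" if "q \<in> pf_perms n" for q
    using that by (simp add: pf_perms_def)
  have at_2: "(front_cycle j \<circ> shift2 q) 2 = j" if "q \<in> pf_perms n" for j q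
    using permutes_not_in[OF perm[OF that], of 0] by (simp add: front_cycle_def shift2_def)
  show "inj_on (\<lambda>(j, q). front_cycle j \<circ> shift2 q) ({2..2 * n + 2} \<times> pf_perms n)"
  proof (rule inj_onI, clarify)
    fix i q j r
    assume *: "i \<in> {2..2 * n + 2}" "q \<in> pf_perms n" "r \<in> pf_perms n"
      and eq: "front_cycle i \<circ> shift2 q = front_cycle j \<circ> shift2 r"
    have "i = j" using at_2[of q i] at_2[of r j] * eq by metis
    moreover have "inj (front_cycle i)"
      using permutes_front_cycle[of i] * permutes_inj by (metis atLeastAtMost_iff)
    ultimately have "shift2 q = shift2 r"
      using eq by (metis fun.inj_map_strong inj_eq comp_apply ext)
    then show "i = j \<and> q = r" using \<open>i = j\<close> by simp
  qed
  show "(\<lambda>(j, q). front_cycle j \<circ> shift2 q) ` ({2..2 * n + 2} \<times> pf_perms n) = pf_perms (Suc n)"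
  proof (intro equalityI subsetI)
    fix p assume "p \<in> (\<lambda>(j, q). front_cycle j \<circ> shift2 q) ` ({2..2 * n + 2} \<times> pf_perms n)"
    then show "p \<in> pf_perms (Suc n)"
      using front_cycle_shift2_mem_pf_perms_iff perm by auto
  next
    fix p assume p: "p \<in> pf_perms (Suc n)"
    define j where "j = p 2"
    have pp: "p permutes {1..2 * n + 2}" using p by (simp add: pf_perms_def)
    have p1: "p 1 = 1" using pf_perms_fix_1[OF p] .
    have "p 2 \<in> {1..2 * n + 2}" by (subst permutes_in_image[OF pp]) auto
    moreover have "p 2 \<noteq> p 1" using permutes_inj[OF pp] by (simp add: inj_eq)
    ultimately have j: "j \<in> {2..2 * n + 2}" using p1 by (auto simp: j_def)
    have c: "front_cycle j permutes {1..2 * n + 2}"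
      using j by (intro permutes_front_cycle) auto
    \<comment> \<open>Undoing the cycle leaves a permutation that fixes both 1 and 2, hence one of
      the form \<open>shift2 q\<close>.\<close>
    let ?r = "inv (front_cycle j) \<circ> p"
    have "?r permutes {1..2 * n + 2}"
      using permutes_compose[OF pp permutes_inv[OF c]] .
    moreover have "?r 1 = 1" "?r 2 = 2"
      using p1 permutes_inv_eq[OF c] by (auto simp: front_cycle_def j_def)
    ultimately obtain q where q: "q permutes {1..2 * n}" "?r = shift2 q"
      by (rule shift2_surj)
    have "p = front_cycle j \<circ> shift2 q"
      unfolding q(2)[symmetric] by (simp add: comp_assoc[symmetric] permutes_inv_o[OF c])
    then show "p \<in> (\<lambda>(j, q). front_cycle j \<circ> shift2 q) ` ({2..2 * n + 2} \<times> pf_perms n)"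
      using p j front_cycle_shift2_mem_pf_perms_iff[OF j q(1)] by auto
  qed
qed

section \<open>Expansion of the Pfaffian along its first row\<close>

lemma pfaffian_0 [simp]: "pfaffian 0 a = 1"
  by (simp add: pfaffian_def pf_perms_0)

text \<open>The sum is reindexed by the pairs \<open>(j, q)\<close>: the cycle contributes the sign
  \<open>(-1) ^ j\<close>, the first pair contributes \<open>a 1 j\<close>, and the rest is a term
  of the smaller Pfaffian.\<close>

lemma pfaffian_Suc:
  "pfaffian (Suc n) a = (\<Sum>j=2..2 * n + 2. (-1) ^ j * a 1 j *
     pfaffian n (\<lambda>k l. a (front_cycle j (k + 2)) (front_cycle j (l + 2))))"
proof -
  \<comment> \<open>\<open>w\<close> is the summand of the large Pfaffian, \<open>v j\<close> that
    of the Pfaffian with 1 and \<open>j\<close> deleted.\<close>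
  define w where "w p = of_int (sign p) * (\<Prod>s=1..Suc n. a (p (2 * s - 1)) (p (2 * s)))" for p
  define v where "v j q = of_int (sign q) * (\<Prod>s=1..n. a (front_cycle j (q (2 * s - 1) + 2))
      (front_cycle j (q (2 * s) + 2)))" for j q
  have w: "w (front_cycle j \<circ> shift2 q) = (-1) ^ j * a 1 j * v j q"
    if j: "j \<in> {2..2 * n + 2}" and "q \<in> pf_perms n" for j q
  proof -
    let ?p = "front_cycle j \<circ> shift2 q"
    have q: "q permutes {1..2 * n}" using that by (simp add: pf_perms_def)
    have "permutation (front_cycle j)" "permutation (shift2 q)"
      using permutes_front_cycle[of j j] j permutes_shift2[OF q] permutation_permutes by fastforce+
    then have sign: "sign ?p = (-1) ^ j * sign q"
      using j by (simp add: sign_compose sign_front_cycle sign_shift2[OF q])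
    have "(\<Prod>s=1..Suc n. a (?p (2 * s - 1)) (?p (2 * s))) =
        a (?p 1) (?p 2) * (\<Prod>s=Suc 1..Suc n. a (?p (2 * s - 1)) (?p (2 * s)))"
      by (subst prod.atLeast_Suc_atMost) auto
    also have "(\<Prod>s=Suc 1..Suc n. a (?p (2 * s - 1)) (?p (2 * s))) =
        (\<Prod>s=1..n. a (?p (2 * Suc s - 1)) (?p (2 * Suc s)))"
      by (rule prod.shift_bounds_cl_Suc_ivl)
    also have "\<dots> = (\<Prod>s=1..n. a (front_cycle j (q (2 * s - 1) + 2)) (front_cycle j (q (2 * s) + 2)))"
      by (intro prod.cong refl) (auto simp: shift2_def)
    also have "?p 1 = 1" by (simp add: front_cycle_def shift2_def)
    also have "?p 2 = j" using permutes_not_in[OF q, of 0] by (simp add: front_cycle_def shift2_def)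
    finally show ?thesis by (simp add: w_def v_def sign mult_ac)
  qed
  have "pfaffian (Suc n) a = sum w (pf_perms (Suc n))"
    by (simp add: pfaffian_def w_def)
  also have "\<dots> = (\<Sum>(j, q)\<in>{2..2 * n + 2} \<times> pf_perms n. w (front_cycle j \<circ> shift2 q))"
    by (subst sum.reindex_bij_betw[OF bij_betw_pf_perms_Suc, symmetric]) (simp add: case_prod_unfold)
  also have "\<dots> = (\<Sum>(j, q)\<in>{2..2 * n + 2} \<times> pf_perms n. (-1) ^ j * a 1 j * v j q)"
    by (intro sum.cong refl) (auto simp: w simp del: o_apply)
  also have "\<dots> = (\<Sum>j=2..2 * n + 2. (-1) ^ j * a 1 j * sum (v j) (pf_perms n))"
    by (simp add: sum.cartesian_product[symmetric] sum_distrib_left)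
  finally show ?thesis
    by (simp add: pfaffian_def v_def)
qed

text \<open>Each factor has its indices in range and in increasing order. This allows
  \<open>a\<close>, specified only above the diagonal, to be replaced by the full cosine
  array.\<close>

lemma pfaffian_cong:
  assumes "\<And>i j. 1 \<le> i \<Longrightarrow> i < j \<Longrightarrow> j \<le> 2 * n \<Longrightarrow> a i j = b i j"
  shows "pfaffian n a = pfaffian n b"
  unfolding pfaffian_def
proof (intro sum.cong refl arg_cong2[of _ _ _ _ "(*)"] prod.cong assms)
  fix p s assume p: "p \<in> pf_perms n" and s: "s \<in> {1..n}"
  have "p permutes {1..2 * n}" using p by (simp add: pf_perms_def)
  then have "p k \<in> {1..2 * n}" if "k \<in> {1..2 * n}" for k
    using that permutes_in_image[of p "{1..2 * n}" k] by blast
  from this[of "2 * s - 1"] this[of "2 * s"] s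
  have "p (2 * s - 1) \<in> {1..2 * n}" "p (2 * s) \<in> {1..2 * n}" by fastforce+
  then show "1 \<le> p (2 * s - 1)" "p (2 * s) \<le> 2 * n" by auto
  show "p (2 * s - 1) < p (2 * s)" using p s by (simp add: pf_perms_def)
qed

section \<open>Alternating sums and the trigonometric identity\<close>

text \<open>Deleting 1 and \<open>j\<close> moves indices below \<open>j\<close> down by one place
  and those above \<open>j\<close> by two, so the two blocks acquire opposite signs.\<close>

lemma alternating_sum_front_cycle:
  fixes x :: "nat \<Rightarrow> 'a::comm_ring_1"
  assumes "2 \<le> j" "j \<le> m + 2"
  shows "(\<Sum>k=1..m. (-1) ^ (k + 1) * x (front_cycle j (k + 2))) =
    (\<Sum>k=2..<j. (-1) ^ k * x k) - (\<Sum>k=Suc j..m + 2. (-1) ^ k * x k)"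
proof -
  have "{1..m} = {1..<j - 1} \<union> {j - 1..m}" using assms by auto
  then have "(\<Sum>k=1..m. (-1) ^ (k + 1) * x (front_cycle j (k + 2))) =
    (\<Sum>k=1..<j - 1. (-1) ^ (k + 1) * x (front_cycle j (k + 2))) +
    (\<Sum>k=j - 1..m. (-1) ^ (k + 1) * x (front_cycle j (k + 2)))"
    by (simp only:) (rule sum.union_disjoint; auto)
  also have "(\<Sum>k=1..<j - 1. (-1) ^ (k + 1) * x (front_cycle j (k + 2))) =
      (\<Sum>k=2..<j. (-1) ^ k * x k)"
    by (rule sum.reindex_bij_witness[of _ "\<lambda>k. k - 1" Suc]) (use assms in \<open>auto simp: front_cycle_def\<close>)
  also have "(\<Sum>k=j - 1..m. (-1) ^ (k + 1) * x (front_cycle j (k + 2))) =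
      (\<Sum>k=Suc j..m + 2. - ((-1) ^ k * x k))"
    by (rule sum.reindex_bij_witness[of _ "\<lambda>k. k - 2" "\<lambda>k. k + 2"])
      (use assms in \<open>auto simp: front_cycle_def Suc_diff_Suc numeral_2_eq_2\<close>)
  finally show ?thesis by (simp add: sum_negf)
qed

text \<open>After product-to-sum, the \<open>c\<close> part of an odd term cancels against the next
  even term and its \<open>d\<close> part against the preceding one. Only the first \<open>c\<close>
  and the last \<open>d\<close> survive.\<close>

lemma sum_alternating_cos:
  fixes x :: "nat \<Rightarrow> real" and t :: real
  defines "T \<equiv> \<lambda>j. \<Sum>k=2..<j. (-1) ^ k * x k"
  shows "(\<Sum>j=2..2 * n + 2. (-1) ^ j * cos (t - x j) * cos (T j - (T (2 * n + 3) - T (Suc j)))) =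
    cos (t - T (2 * n + 3))"
proof -
  define S where "S = T (2 * n + 3)"
  \<comment> \<open>With \<open>T (Suc j) = T j + (-1) ^ j * x j\<close>, the variable
    \<open>x j\<close> drops out of both cosine arguments, leaving these two forms.\<close>
  define c where "c j = cos (t - S + 2 * T j) / 2" for j
  define d where "d j = cos (t + S - 2 * T j) / 2" for j
  have T_Suc: "T (Suc j) = T j + (-1) ^ j * x j" if "2 \<le> j" for j
    using that by (simp add: T_def)
  have prod: "cos (t - x j) * cos (T j - (S - T (Suc j))) =
      cos (t - x j + (T j - (S - T (Suc j)))) / 2 + cos (t - x j - (T j - (S - T (Suc j)))) / 2" for j
    by (simp add: cos_times_cos add_divide_distrib)
  define g where "g j = (-1) ^ j * cos (t - x j) * cos (T j - (S - T (Suc j)))" for j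
  have even_term: "g j = c j + d (Suc j)"
    if "even j" "2 \<le> j" for j
    using that prod[of j] by (simp add: g_def c_def d_def T_Suc algebra_simps)
  have odd_term: "g j = - c (Suc j) - d j"
    if "odd j" "2 \<le> j" for j
    using that prod[of j] by (simp add: g_def c_def d_def T_Suc algebra_simps)
  have "sum g {2..2 * m + 2} = c 2 + d (2 * m + 3)" for m
  proof (induction m)
    case 0
    then show ?case using even_term[of 2] by (simp add: numeral_eq_Suc)
  next
    case (Suc m)
    have "{2..2 * Suc m + 2} = insert (2 * m + 4) (insert (2 * m + 3) {2..2 * m + 2})" by auto
    then have "sum g {2..2 * Suc m + 2} = sum g {2..2 * m + 2} + g (2 * m + 3) + g (2 * m + 4)"
      by (simp only:) simp
    also have "g (2 * m + 3) = - c (2 * m + 4) - d (2 * m + 3)"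
      using odd_term[of "2 * m + 3"] by (simp add: add.commute)
    also have "g (2 * m + 4) = c (2 * m + 4) + d (2 * Suc m + 3)"
      using even_term[of "2 * m + 4"] by (simp add: add.commute)
    finally show ?case
      using Suc by simp
  qed
  \<comment> \<open>As \<open>T 2 = 0\<close> and \<open>T (2 * n + 3) = S\<close>, both surviving
    terms equal \<open>cos (t - S) / 2\<close>.\<close>
  from this[of n] show ?thesis
    by (simp add: g_def c_def d_def S_def[symmetric]) (simp add: T_def)
qed

theorem theorem1p4:
  fixes n :: nat and x :: "nat \<Rightarrow> real" and a :: "nat \<Rightarrow> nat \<Rightarrow> real"
  assumes "n \<ge> 1"
    and "\<And>i j. 1 \<le> i \<Longrightarrow> i < j \<Longrightarrow> j \<le> 2 * n \<Longrightarrow> a i j = cos (x i - x j)"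
  shows "pfaffian n a = cos (\<Sum>k=1..2 * n. (-1) ^ (k + 1) * x k)"
proof -
  have "pfaffian n (\<lambda>i j. cos (x i - x j)) = cos (\<Sum>k=1..2 * n. (-1) ^ (k + 1) * x k)"
  \<comment> \<open>The variables are generalised because the induction hypothesis is applied, for
    each \<open>j\<close>, to the sequence with \<open>x 1\<close> and \<open>x j\<close> removed.
    The base case is \<open>1 = cos 0\<close>.\<close>
  proof (induction n arbitrary: x)
    case 0
    then show ?case by simp
  next
    case (Suc n)
    define T where "T j = (\<Sum>k=2..<j. (-1) ^ k * x k)" for j
    have split: "(\<Sum>k=Suc j..2 * n + 2. (-1) ^ k * x k) = T (2 * n + 3) - T (Suc j)"
      if "j \<in> {2..2 * n + 2}" for j
    proof -
      have "{2..<2 * n + 3} = {2..<Suc j} \<union> {Suc j..2 * n + 2}" using that by auto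
      then have "T (2 * n + 3) = T (Suc j) + (\<Sum>k=Suc j..2 * n + 2. (-1) ^ k * x k)"
        unfolding T_def by (simp only:) (rule sum.union_disjoint; auto)
      then show ?thesis by simp
    qed
    have "pfaffian (Suc n) (\<lambda>i j. cos (x i - x j)) =
        (\<Sum>j=2..2 * n + 2. (-1) ^ j * cos (x 1 - x j) *
          cos (\<Sum>k=1..2 * n. (-1) ^ (k + 1) * x (front_cycle j (k + 2))))"
      unfolding pfaffian_Suc using Suc[of "\<lambda>k. x (front_cycle _ (k + 2))"] by simp
    also have "\<dots> = (\<Sum>j=2..2 * n + 2. (-1) ^ j * cos (x 1 - x j) *
        cos (T j - (T (2 * n + 3) - T (Suc j))))"
      by (intro sum.cong refl arg_cong2[of _ _ _ _ "(*)"] arg_cong[of _ _ cos])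
        (subst alternating_sum_front_cycle,
          use split in \<open>auto simp: T_def[symmetric] simp del: sum.cl_ivl_Suc\<close>)
    also have "\<dots> = cos (x 1 - T (2 * n + 3))"
      unfolding T_def by (rule sum_alternating_cos)
    \<comment> \<open>\<open>T\<close> carries the sign \<open>(-1) ^ k\<close>, opposite to the one
      in the claim, hence the subtraction.\<close>
    also have "x 1 - T (2 * n + 3) = (\<Sum>k=1..2 * Suc n. (-1) ^ (k + 1) * x k)"
    proof -
      have "{2..<2 * n + 3} = {Suc 1..2 * Suc n}" by auto
      then have "(\<Sum>k=1..2 * Suc n. (-1) ^ (k + 1) * x k) =
          x 1 + (\<Sum>k\<in>{2..<2 * n + 3}. - ((-1) ^ k * x k))"
        by (subst sum.atLeast_Suc_atMost) auto
      then show ?thesis by (simp add: T_def sum_negf)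
    qed
    finally show ?case .
  qed
  moreover have "pfaffian n a = pfaffian n (\<lambda>i j. cos (x i - x j))"
    by (rule pfaffian_cong) (rule assms(2))
  ultimately show ?thesis by simp
qed

end
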